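(* For $k\ge 1$ and $m\ge 3$, the graph $P_{2k}\,\square\, C_m$ (Cartesian product of the path on $2k$ vertices and the cycle on $m$ vertices) is a ${\cal D}$ graph for the Maker-Breaker total domination game.
   Context: All graphs are finite and simple. The Maker-Breaker total domination game on a graph $G$ is played by Dominator and Staller, who alternately select a vertex of $G$ not selected before. Dominator wins if at some point the set of vertices he has selected is a total dominating set of $G$ (every vertex has a neighbour in it); otherwise Staller wins. A graph is ${\cal D}$ if Dominator has a winning strategy both when he moves first and when Staller moves first. *)

theory Defs
  imports "Graph_Theory.Pair_Digraph"
begin

text \<open>
  A finite simple graph is a \<^locale>\<open>pair_graph\<close>: an irreflexive symmetric set
  \<^const>\<open>parcs\<close> of ordered pairs over a finite vertex set \<^const>\<open>pverts\<close>. An undirected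
  edge is represented by both of its orientations.
\<close>

definition path_graph :: "nat \<Rightarrow> nat pair_pre_digraph" where
  "path_graph n = \<lparr>pverts = {..<n},
     parcs = {(i, j). i < n \<and> j < n \<and> (j = Suc i \<or> i = Suc j)}\<rparr>"

text \<open>This is the cycle on \<open>n\<close> vertices only for \<open>n \<ge> 3\<close>.\<close>

definition cycle_graph :: "nat \<Rightarrow> nat pair_pre_digraph" where
  "cycle_graph n = \<lparr>pverts = {..<n},
     parcs = {(i, j). i < n \<and> j < n \<and> (j = Suc i mod n \<or> i = Suc j mod n)}\<rparr>"

definition cartesian_product ::
    "'a pair_pre_digraph \<Rightarrow> 'b pair_pre_digraph \<Rightarrow> ('a \<times> 'b) pair_pre_digraph"
    (infixr "\<box>" 70) where
  "G \<box> H = \<lparr>pverts = pverts G \<times> pverts H,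
     parcs = {((u, v), (u', v')).
       (u = u' \<and> u \<in> pverts G \<and> (v, v') \<in> parcs H) \<or>
       (v = v' \<and> v \<in> pverts H \<and> (u, u') \<in> parcs G)}\<rparr>"

lemma pair_graph_path_graph: "pair_graph (path_graph n)"
proof
  show "finite (parcs (path_graph n))"
    by (rule finite_subset[of _ "{..<n} \<times> {..<n}"]) (auto simp: path_graph_def)
qed (auto simp: path_graph_def symmetric_def sym_def)

lemma pair_graph_cycle_graph:
  assumes "n \<ge> 3"
  shows "pair_graph (cycle_graph n)"
proof
  show "finite (parcs (cycle_graph n))"
    by (rule finite_subset[of _ "{..<n} \<times> {..<n}"]) (auto simp: cycle_graph_def)
  show "fst e \<noteq> snd e" if "e \<in> parcs (cycle_graph n)" for e
    using that assms by (auto simp: cycle_graph_def mod_Suc split: if_splits)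
qed (auto simp: cycle_graph_def symmetric_def sym_def)

lemma pair_graph_cartesian_product:
  assumes "pair_graph G" "pair_graph H"
  shows "pair_graph (G \<box> H)"
proof -
  interpret G: pair_graph G by fact
  interpret H: pair_graph H by fact
  have verts: "pverts (G \<box> H) = pverts G \<times> pverts H"
    by (simp add: cartesian_product_def)
  have sub: "parcs (G \<box> H) \<subseteq> (pverts G \<times> pverts H) \<times> (pverts G \<times> pverts H)"
    by (auto simp: cartesian_product_def dest: G.in_arcsD1 G.in_arcsD2 H.in_arcsD1 H.in_arcsD2)
  show ?thesis
  proof
    show "finite (parcs (G \<box> H))"
      by (rule finite_subset[OF sub]) simp
    show "fst e \<in> pverts (G \<box> H)" "snd e \<in> pverts (G \<box> H)" if "e \<in> parcs (G \<box> H)" for e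
      using subsetD[OF sub that] by (auto simp: verts)
    show "fst e \<noteq> snd e" if "e \<in> parcs (G \<box> H)" for e
      using that G.no_loops H.no_loops by (fastforce simp: cartesian_product_def)
    show "symmetric (with_proj (G \<box> H))"
      using G.sym_arcs H.sym_arcs
      by (auto simp: symmetric_def sym_def cartesian_product_def)
  qed (simp add: verts)
qed

definition total_dominating_set :: "'a pair_pre_digraph \<Rightarrow> 'a set \<Rightarrow> bool" where
  "total_dominating_set G S \<longleftrightarrow>
     S \<subseteq> pverts G \<and> (\<forall>v\<in>pverts G. \<exists>u\<in>S. (v, u) \<in> parcs G)"

datatype player = Dominator | Staller

text \<open>
  A play is the list of the vertices selected so far, in order of selection. The parameter
  \<open>first\<close> is the player who moves first, so \<open>to_move first i\<close> makes the selection at index \<open>i\<close>.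
\<close>

fun opponent :: "player \<Rightarrow> player" where
  "opponent Dominator = Staller"
| "opponent Staller = Dominator"

definition to_move :: "player \<Rightarrow> nat \<Rightarrow> player" where
  "to_move first i = (if even i then first else opponent first)"

definition play :: "'a pair_pre_digraph \<Rightarrow> 'a list \<Rightarrow> bool" where
  "play G xs \<longleftrightarrow> distinct xs \<and> set xs \<subseteq> pverts G"

definition complete_play :: "'a pair_pre_digraph \<Rightarrow> 'a list \<Rightarrow> bool" where
  "complete_play G xs \<longleftrightarrow> play G xs \<and> set xs = pverts G"

definition selected_by :: "player \<Rightarrow> player \<Rightarrow> 'a list \<Rightarrow> 'a set" where
  "selected_by p first xs = {xs ! i | i. i < length xs \<and> to_move first i = p}"

text \<open>
  The game may be played on until all vertices are selected: Dominator wins if his selected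
  vertices form a total dominating set after some initial segment of the play.
\<close>

definition dominator_wins :: "'a pair_pre_digraph \<Rightarrow> player \<Rightarrow> 'a list \<Rightarrow> bool" where
  "dominator_wins G first xs \<longleftrightarrow>
     (\<exists>n\<le>length xs. total_dominating_set G (selected_by Dominator first (take n xs)))"

text \<open>
  A strategy maps the play so far to the next vertex; it must always give a legal move, as
  otherwise no play would follow it to the end and it would be winning vacuously.
\<close>

definition strategy ::
    "'a pair_pre_digraph \<Rightarrow> player \<Rightarrow> player \<Rightarrow> ('a list \<Rightarrow> 'a) \<Rightarrow> bool" where
  "strategy G p first \<sigma> \<longleftrightarrow>
     (\<forall>xs. play G xs \<and> \<not> complete_play G xs \<and> to_move first (length xs) = p
        \<longrightarrow> \<sigma> xs \<in> pverts G - set xs)"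

definition follows :: "player \<Rightarrow> player \<Rightarrow> ('a list \<Rightarrow> 'a) \<Rightarrow> 'a list \<Rightarrow> bool" where
  "follows p first \<sigma> xs \<longleftrightarrow>
     (\<forall>i<length xs. to_move first i = p \<longrightarrow> xs ! i = \<sigma> (take i xs))"

definition dominator_has_winning_strategy :: "'a pair_pre_digraph \<Rightarrow> player \<Rightarrow> bool" where
  "dominator_has_winning_strategy G first \<longleftrightarrow>
     (\<exists>\<sigma>. strategy G Dominator first \<sigma> \<and>
        (\<forall>xs. complete_play G xs \<and> follows Dominator first \<sigma> xs \<longrightarrow> dominator_wins G first xs))"

definition D_graph :: "'a pair_pre_digraph \<Rightarrow> bool" where
  "D_graph G \<longleftrightarrow>
     dominator_has_winning_strategy G Dominator \<and> dominator_has_winning_strategy G Staller"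

end

theory Submission
  imports Defs
begin

text \<open>
  Dominator wins by a pairing strategy: if the vertices are paired off so that every open
  neighbourhood contains a pair, then answering each move of Staller by its partner
  prevents Staller from ever owning a whole neighbourhood. In \<open>P\<^sub>2 \<box> C\<^sub>m\<close> the diagonal pairs
  \<open>{(0, j), (1, j + 1)}\<close> do this, since the common neighbours of that pair are
  \<open>(0, j + 1)\<close> and \<open>(1, j)\<close>. As \<open>P\<^bsub>2k\<^esub> \<box> C\<^sub>m\<close> is spanned by \<open>k\<close> disjoint copies
  of \<open>P\<^sub>2 \<box> C\<^sub>m\<close>, the same pairing in every copy works.
\<close>

lemma pairing_winning_strategy:
  fixes G :: "'a pair_pre_digraph"
  assumes closed: "\<And>x. x \<in> pverts G \<Longrightarrow> p x \<in> pverts G"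
    and invol: "\<And>x. x \<in> pverts G \<Longrightarrow> p (p x) = x"
    and no_fix: "\<And>x. x \<in> pverts G \<Longrightarrow> p x \<noteq> x"
    and pair: "\<And>v. v \<in> pverts G \<Longrightarrow> \<exists>u\<in>pverts G. (v, u) \<in> parcs G \<and> (v, p u) \<in> parcs G"
  shows "dominator_has_winning_strategy G first"
proof -
  \<comment> \<open>When Dominator is to move, \<open>last xs\<close> is Staller's latest selection.
    The arbitrary free vertex covers an opening move by Dominator and a partner already taken, so
    the strategy is always legal.\<close>
  define \<sigma> where "\<sigma> xs = (if xs \<noteq> [] \<and> p (last xs) \<notin> set xs then p (last xs)
      else (SOME x. x \<in> pverts G - set xs))" for xs
  have strat: "strategy G Dominator first \<sigma>"
    unfolding strategy_def
  proof (intro allI impI)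
    fix xs
    assume "play G xs \<and> \<not> complete_play G xs \<and> to_move first (length xs) = Dominator"
    then have sub: "set xs \<subseteq> pverts G" and ne: "\<exists>x. x \<in> pverts G - set xs"
      by (auto simp: play_def complete_play_def)
    show "\<sigma> xs \<in> pverts G - set xs"
    proof (cases "xs \<noteq> [] \<and> p (last xs) \<notin> set xs")
      case True
      then have "p (last xs) \<in> pverts G" using closed sub last_in_set[of xs] by blast
      with True show ?thesis by (simp add: \<sigma>_def)
    next
      case False
      then have "\<sigma> xs = (SOME x. x \<in> pverts G - set xs)" by (simp only: \<sigma>_def if_False)
      then show ?thesis using someI_ex[OF ne] by simp
    qed
  qed
  have "dominator_wins G first xs"
    if comp: "complete_play G xs" and fol: "follows Dominator first \<sigma> xs" for xs
  proof -
    have dist: "distinct xs" and all: "set xs = pverts G"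
      using comp by (auto simp: play_def complete_play_def)
    \<comment> \<open>If Staller took both vertices of a pair, at times \<open>i < j\<close>, the
      second was still free at time \<open>Suc i\<close>. Dominator would have taken it then, and no
      vertex is selected twice.\<close>
    have answered: False
      if ij: "i < j" "j < length xs" "xs ! j = p (xs ! i)"
        "to_move first i \<noteq> Dominator" "to_move first j \<noteq> Dominator" for i j
    proof -
      have dom: "to_move first (Suc i) = Dominator"
        using ij(4) by (cases first) (auto simp: to_move_def split: if_splits)
      then have "Suc i \<noteq> j" using ij(5) by auto
      then have "Suc i < j" using ij(1) by simp
      then have len: "Suc i < length xs" using ij(2) by simp
      have tk: "take (Suc i) xs = take i xs @ [xs ! i]"
        using len by (simp add: take_Suc_conv_app_nth)
      have "p (xs ! i) \<notin> set (take (Suc i) xs)"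
      proof
        assume "p (xs ! i) \<in> set (take (Suc i) xs)"
        then obtain l where "l < Suc i" "xs ! l = xs ! j"
          using ij(3) len by (auto simp: in_set_conv_nth)
        then show False
          using nth_eq_iff_index_eq[OF dist, of l j] ij(1,2) by auto
      qed
      then have "\<sigma> (take (Suc i) xs) = p (xs ! i)"
        unfolding \<sigma>_def by (simp add: tk)
      then have "xs ! Suc i = xs ! j"
        using fol dom len ij(3) by (auto simp: follows_def)
      then show False
        using nth_eq_iff_index_eq[OF dist, of "Suc i" j] len ij(2) \<open>Suc i \<noteq> j\<close> by auto
    qed
    have "\<exists>u \<in> selected_by Dominator first xs. (v, u) \<in> parcs G" if v: "v \<in> pverts G" for v
    proof -
      obtain u where u: "u \<in> pverts G" "(v, u) \<in> parcs G" "(v, p u) \<in> parcs G"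
        using pair[OF v] by blast
      \<comment> \<open>A complete play contains both \<open>u\<close> and \<open>p u\<close>; as
        \<open>p\<close> is an involution, \<open>answered\<close> applies whichever came
        first.\<close>
      obtain i where i: "i < length xs" "xs ! i = u"
        using u(1) all by (metis in_set_conv_nth)
      obtain j where j: "j < length xs" "xs ! j = p u"
        using closed[OF u(1)] all by (metis in_set_conv_nth)
      have "i \<noteq> j" using i j no_fix[OF u(1)] by auto
      then consider "i < j" | "j < i" by linarith
      then have "to_move first i = Dominator \<or> to_move first j = Dominator"
        using answered[of i j] answered[of j i] i j invol[OF u(1)] by cases auto
      then have "u \<in> selected_by Dominator first xs \<or> p u \<in> selected_by Dominator first xs"
        unfolding selected_by_def mem_Collect_eq using i j by metis
      then show ?thesis using u(2,3) by auto
    qed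
    moreover have "selected_by Dominator first xs \<subseteq> pverts G"
      unfolding selected_by_def all[symmetric] by auto
    ultimately show ?thesis
      unfolding dominator_wins_def total_dominating_set_def
      by (intro exI[of _ "length xs"]) simp
  qed
  with strat show ?thesis
    unfolding dominator_has_winning_strategy_def by blast
qed

text \<open>The conditionals are the shifts by one modulo \<open>m\<close>, forward on even rows and
  backward on odd ones, so the two branches are mutually inverse.\<close>

fun diagonal_partner :: "nat \<Rightarrow> nat \<times> nat \<Rightarrow> nat \<times> nat" where
  "diagonal_partner m (i, j) =
     (if even i then (Suc i, if Suc j = m then 0 else Suc j)
      else (i - 1, if j = 0 then m - 1 else j - 1))"

theorem theorem4p3:
  fixes k m :: nat
  assumes "k \<ge> 1" and "m \<ge> 3"
  shows "D_graph (path_graph (2 * k) \<box> cycle_graph m)"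
proof -
  let ?G = "path_graph (2 * k) \<box> cycle_graph m"
  let ?p = "diagonal_partner m"
  have verts: "pverts ?G = {..<2 * k} \<times> {..<m}"
    by (simp add: cartesian_product_def path_graph_def cycle_graph_def)
  \<comment> \<open>The even number of rows enters here: the last row is odd, so every even row has
    a next row to pair with.\<close>
  have even_Suc: "Suc i < 2 * k" if "even i" "i < 2 * k" for i
    using that by presburger
  have "dominator_has_winning_strategy ?G first" for first
  proof (rule pairing_winning_strategy[where p = ?p])
    fix x assume "x \<in> pverts ?G"
    then obtain i j where x: "x = (i, j)" "i < 2 * k" "j < m"
      by (auto simp: verts)
    show "?p x \<in> pverts ?G"
      using x even_Suc[of i] by (auto simp: verts)
    show "?p (?p x) = x"
      using x by (auto elim: oddE)
    show "?p x \<noteq> x"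
      using x by (auto elim: oddE)
    show "\<exists>u\<in>pverts ?G. (x, u) \<in> parcs ?G \<and> (x, ?p u) \<in> parcs ?G"
    proof (cases "even i")
      case True
      \<comment> \<open>The cyclic predecessor of \<open>x\<close> in its row; its diagonal partner
        is the neighbour of \<open>x\<close> in row \<open>Suc i\<close>.\<close>
      let ?u = "(i, if j = 0 then m - 1 else j - 1)"
      have "?p ?u = (Suc i, j)" using True x assms by auto
      moreover have "(x, ?u) \<in> parcs ?G"
        using x assms
        by (auto simp: cartesian_product_def path_graph_def cycle_graph_def mod_Suc)
      moreover have "(x, (Suc i, j)) \<in> parcs ?G"
        using x even_Suc[OF True]
        by (auto simp: cartesian_product_def path_graph_def cycle_graph_def)
      moreover have "?u \<in> pverts ?G" using x by (auto simp: verts)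
      ultimately show ?thesis by (intro bexI[of _ ?u]) simp_all
    next
      case False
      \<comment> \<open>Mirror image: the neighbour in row \<open>i - 1\<close> is paired with the
        cyclic successor of \<open>x\<close> in its own row.\<close>
      let ?u = "(i - 1, j)" and ?w = "(i, if Suc j = m then 0 else Suc j)"
      have "?p ?u = ?w" using False x by (auto elim: oddE)
      moreover have "(x, ?u) \<in> parcs ?G"
        using x False
        by (auto simp: cartesian_product_def path_graph_def cycle_graph_def elim: oddE)
      moreover have "(x, ?w) \<in> parcs ?G"
        using x assms
        by (auto simp: cartesian_product_def path_graph_def cycle_graph_def mod_Suc)
      moreover have "?u \<in> pverts ?G" using x by (auto simp: verts)
      ultimately show ?thesis by (intro bexI[of _ ?u]) simp_all
    qed
  qed
  then show ?thesis by (simp add: D_graph_def)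
qed

end
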